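(* For every $n\ge 0$, the Hankel determinant $H_{n}(\widetilde{\alpha}_{k}(x))$ is a polynomial in $x$ of degree $\frac{n(n+1)}{2}$ with leading coefficient \begin{equation*} \big[x^{\frac{n(n+1)}{2}}\big]H_{n}(\widetilde{\alpha}_{k}(x))=\alpha_{0}\alpha_{1}\cdots \alpha_{n}(-1)^{\binom{n+1}{2}}q^{2\binom{n+1}{3}}\prod_{j=1}^{n}(1-q^{j})^{n+1-j}. \end{equation*}
   Context: For a sequence $(a_k)_{k\ge0}$, $H_n(a_k):=\det_{0\le i,j\le n}(a_{i+j})$ denotes its $n$-th Hankel determinant. The $q$-Pochhammer symbol is $(A;q)_N:=\prod_{k=0}^{N-1}(1-Aq^k)$, and the $q$-binomial coefficient is $\genfrac{[}{]}{0pt}{}{n}{k}_q:=\frac{(q;q)_n}{(q;q)_k(q;q)_{n-k}}$ for $0\le k\le n$ and $0$ otherwise. Let $(\alpha_k)_{k\ge0}$ be an arbitrary sequence and define the polynomials \begin{align*} \widetilde{\alpha}_{k}(x):=\sum_{\ell=0}^{k}q^{\binom{\ell}{2}}\genfrac{[}{]}{0pt}{}{k}{\ell}_{q}\alpha_{\ell}x^{k-\ell}. \end{align*}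
   Formalization: For arbitrary α the degree can drop (n=1, α_0=0 gives H_1=−α_1²), so it is shown that the degree is at most n(n+1)/2 with the stated coefficient there, and exactly n(n+1)/2 when q and α_0,…,α_n are nonzero; q^j≠1 for 1≤j≤2n makes the q-binomials defined. *)

theory Defs
  imports
    "HOL-Computational_Algebra.Polynomial"
    "Jordan_Normal_Form.Determinant"
begin

definition q_pochhammer :: "'a::comm_ring_1 \<Rightarrow> 'a \<Rightarrow> nat \<Rightarrow> 'a" where
  "q_pochhammer a q n = (\<Prod>k<n. 1 - a * q ^ k)"

text \<open>
  The quotient is meaningful only if the denominator is nonzero, that is, if \<open>q ^ j \<noteq> 1\<close>
  for \<open>1 \<le> j \<le> max k (n - k)\<close>; otherwise it is \<open>0\<close> by the convention \<open>x / 0 = 0\<close>.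
\<close>
definition q_binomial :: "'a::field \<Rightarrow> nat \<Rightarrow> nat \<Rightarrow> 'a" where
  "q_binomial q n k =
     (if k \<le> n then q_pochhammer q q n / (q_pochhammer q q k * q_pochhammer q q (n - k)) else 0)"

text \<open>
  Following the usual convention for Hankel determinants with indices \<open>0 \<le> i, j \<le> n\<close>,
  the \<open>n\<close>-th one has size \<open>n + 1\<close>.
\<close>
definition hankel_det :: "(nat \<Rightarrow> 'a::comm_ring_1) \<Rightarrow> nat \<Rightarrow> 'a" where
  "hankel_det a n = det (mat (n + 1) (n + 1) (\<lambda>(i, j). a (i + j)))"

definition alpha_tilde :: "'a::field \<Rightarrow> (nat \<Rightarrow> 'a) \<Rightarrow> nat \<Rightarrow> 'a poly" where
  "alpha_tilde q \<alpha> k =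
     (\<Sum>l\<le>k. monom (q ^ (l choose 2) * q_binomial q k l * \<alpha> l) (k - l))"

end

theory Submission
  imports Defs
begin

text \<open>
  For \<open>l \<le> N\<close> the factor \<open>q ^ (l choose 2) * q_binomial q N l\<close> is the polynomial
  \<open>\<Prod>k<l. (q ^ k - y)\<close>, evaluated at \<open>y = q ^ N\<close> and divided by \<open>q_pochhammer q q l\<close>; it vanishes
  at \<open>y = q ^ N\<close> for \<open>l > N\<close>. Collecting powers of \<open>y\<close> and multiplying by \<open>x ^ (2 * n)\<close>
  writes the entry \<open>(i, j)\<close> of the Hankel matrix as the sum over \<open>m \<le> 2 * n\<close> of
  \<open>(q ^ (i * m) * x ^ i) * E m * (q ^ (j * m) * x ^ j)\<close>, where \<open>E m\<close> has degree at most \<open>2 * n - m\<close>.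
  Expanding the determinant by rows gives one term for each choice \<open>f\<close> of an index \<open>m = f i\<close> in
  every row \<open>i\<close>. The term vanishes unless \<open>f\<close> is injective, and its degree drops with the sum of
  the \<open>f i\<close>, so only the permutations of \<open>{0..n}\<close> reach the top degree. They add up to the square of
  the Vandermonde determinant of the \<open>q ^ i\<close> times the leading coefficients of the \<open>E m\<close>. No inverse
  of \<open>q\<close> occurs, so \<open>q = 0\<close> needs no separate treatment.
\<close>

section \<open>Top coefficients of products, and sets of minimal sum\<close>

text \<open>Upper bounds in place of exact degrees keep this valid when a top coefficient vanishes,
  for instance when some \<open>\<alpha> m\<close> is 0.\<close>

lemma coeff_mult_of_degree_le:
  fixes p r :: "'a::comm_semiring_1 poly"
  assumes "degree p \<le> a" "degree r \<le> b"
  shows "coeff (p * r) (a + b) = coeff p a * coeff r b"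
proof -
  have "coeff (p * r) (a + b) = (\<Sum>i\<le>a + b. coeff p i * coeff r (a + b - i))"
    by (rule coeff_mult)
  also have "\<dots> = (\<Sum>i\<in>{a}. coeff p i * coeff r (a + b - i))"
  proof (intro sum.mono_neutral_right ballI)
    fix i assume "i \<in> {..a + b} - {a}"
    hence "i > a \<or> a + b - i > b" by auto
    thus "coeff p i * coeff r (a + b - i) = 0"
      using assms by (auto simp: coeff_eq_0)
  qed auto
  finally show ?thesis by simp
qed

lemma degree_coeff_prod_of_degree_le:
  fixes p :: "'b \<Rightarrow> 'a::comm_semiring_1 poly"
  assumes "finite A" "\<And>i. i \<in> A \<Longrightarrow> degree (p i) \<le> k i"
  shows "degree (prod p A) \<le> sum k A \<and> coeff (prod p A) (sum k A) = (\<Prod>i\<in>A. coeff (p i) (k i))"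
  using assms
proof (induction A rule: finite_induct)
  case (insert x A)
  have le: "degree (prod p A) \<le> sum k A" "degree (p x) \<le> k x" using insert by auto
  have "degree (p x * prod p A) \<le> k x + sum k A"
    using degree_mult_le[of "p x" "prod p A"] le by linarith
  thus ?case using insert le by (simp add: coeff_mult_of_degree_le)
qed simp

text \<open>Induction by removing the maximum \<open>M\<close>: \<open>A\<close> lies in
  \<open>{..M}\<close>, so \<open>M\<close> is at least its cardinality minus 1. The equality case
  is what later singles out the permutations.\<close>

lemma sum_lessThan_card_le:
  fixes A :: "nat set"
  assumes "finite A" "card A = N"
  shows "(\<Sum>i<N. i) \<le> \<Sum>A \<and> ((\<Sum>i<N. i) = \<Sum>A \<longrightarrow> A = {..<N})"
  using assms
proof (induction N arbitrary: A)
  case (Suc N)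
  define M where "M = Max A"
  have ne: "A \<noteq> {}" using Suc.prems by auto
  have M: "M \<in> A" using Suc.prems ne by (simp add: M_def)
  have "A \<subseteq> {..M}" using Suc.prems by (auto simp: M_def)
  hence "card A \<le> card {..M}" by (intro card_mono) auto
  hence MN: "N \<le> M" using Suc.prems by simp
  have IH: "(\<Sum>i<N. i) \<le> \<Sum>(A - {M})" "(\<Sum>i<N. i) = \<Sum>(A - {M}) \<longrightarrow> A - {M} = {..<N}"
    using Suc.IH[of "A - {M}"] Suc.prems M by auto
  have S: "\<Sum>A = M + \<Sum>(A - {M})" using sum.remove[of A M "\<lambda>i. i"] Suc.prems(1) M by simp
  show ?case
  proof (intro conjI impI)
    show "(\<Sum>i<Suc N. i) \<le> \<Sum>A" using IH MN S by simp
    assume "(\<Sum>i<Suc N. i) = \<Sum>A"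
    hence "M = N" "A - {M} = {..<N}" using IH MN S by simp_all
    thus "A = {..<Suc N}" using insert_Diff[OF M] by (simp add: lessThan_Suc)
  qed
qed simp

section \<open>Expansion of determinants\<close>

text \<open>Multilinearity in the rows, as in the first half of the Cauchy-Binet formula. Fixing
  \<open>f\<close> to be the identity outside \<open>{0..<N}\<close> matches the convention of
  \<open>permutes\<close>.\<close>

lemma det_mat_row_sums:
  fixes u :: "nat \<Rightarrow> nat \<Rightarrow> 'a::comm_ring_1"
  assumes "finite S"
  shows "det (mat N N (\<lambda>(i, j). \<Sum>m\<in>S. u i m * w m j)) =
    (\<Sum>f | (\<forall>i\<in>{0..<N}. f i \<in> S) \<and> (\<forall>i. i \<notin> {0..<N} \<longrightarrow> f i = i).
       (\<Prod>i<N. u i (f i)) * det (mat N N (\<lambda>(i, j). w (f i) j)))"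
proof -
  let ?a = "\<lambda>i m. u i m \<cdot>\<^sub>v vec N (w m)"
  have "mat N N (\<lambda>(i, j). \<Sum>m\<in>S. u i m * w m j) =
      mat\<^sub>r N N (\<lambda>i. finsum_vec TYPE('a) N (?a i) S)"
    by (rule eq_matI) (auto simp: index_finsum_vec assms)
  hence "det (mat N N (\<lambda>(i, j). \<Sum>m\<in>S. u i m * w m j)) =
    (\<Sum>f | (\<forall>i\<in>{0..<N}. f i \<in> S) \<and> (\<forall>i. i \<notin> {0..<N} \<longrightarrow> f i = i). det (mat\<^sub>r N N (\<lambda>i. ?a i (f i))))"
    using det_linear_rows_sum[of S ?a N] assms by auto
  moreover have "det (mat\<^sub>r N N (\<lambda>i. ?a i (f i))) =
      (\<Prod>i<N. u i (f i)) * det (mat N N (\<lambda>(i, j). w (f i) j))" for f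
  proof -
    have "mat\<^sub>r N N (\<lambda>i. vec N (w (f i))) = mat N N (\<lambda>(i, j). w (f i) j)"
      by (rule eq_matI) auto
    thus ?thesis
      using det_rows_mul[of "\<lambda>i. vec N (w (f i))" N "\<lambda>i. u i (f i)"] by (simp add: lessThan_atLeast0)
  qed
  ultimately show ?thesis by (simp only:)
qed

lemma prod_monom: "(\<Prod>i\<in>A. monom (c i) (k i)) = monom (\<Prod>i\<in>A. c i) (\<Sum>i\<in>A. k i)"
  by (induction A rule: infinite_finite_induct) (auto simp: mult_monom)

text \<open>Every Leibniz term uses each column exactly once, so all terms carry the same power of
  the variable.\<close>

lemma det_mat_monom_cols:
  fixes g :: "nat \<Rightarrow> nat \<Rightarrow> 'a::comm_ring_1"
  shows "det (mat N N (\<lambda>(i, j). monom (g i j) j)) =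
    monom (det (mat N N (\<lambda>(i, j). g i j))) (\<Sum>j<N. j)"
proof -
  have "signof p * (\<Prod>i = 0..<N. monom (g i (p i)) (p i)) =
      monom (signof p * (\<Prod>i = 0..<N. g i (p i))) (\<Sum>j<N. j)"
    if p: "p permutes {0..<N}" for p
  proof -
    have "(\<Sum>i = 0..<N. p i) = (\<Sum>j<N. j)"
      using sum.permute[OF p, of id] by (simp add: lessThan_atLeast0 comp_def)
    thus ?thesis by (cases p rule: sign_cases) (simp_all add: prod_monom minus_monom)
  qed
  thus ?thesis
    by (subst (1 2) det_def'[where n = N]) (auto simp: monom_sum intro!: sum.cong)
qed

section \<open>Vandermonde determinant through the Newton basis\<close>

text \<open>
  Coefficients of \<open>y ^ i\<close> in the Newton basis \<open>\<Prod>k<l. (y - x k)\<close>. They give an LU factorization of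
  the Vandermonde matrix.
\<close>
fun newton_coeff :: "(nat \<Rightarrow> 'a::comm_ring_1) \<Rightarrow> nat \<Rightarrow> nat \<Rightarrow> 'a" where
  "newton_coeff x 0 l = (if l = 0 then 1 else 0)"
| "newton_coeff x (Suc i) l =
    (if l = 0 then 0 else newton_coeff x i (l - 1)) + x l * newton_coeff x i l"

lemma newton_coeff_eq_0: "i < l \<Longrightarrow> newton_coeff x i l = 0"
  by (induction i arbitrary: l) auto

lemma newton_coeff_diag: "newton_coeff x i i = 1"
  by (induction i) (auto simp: newton_coeff_eq_0)

lemma power_eq_newton_sum:
  fixes y :: "'a::comm_ring_1"
  assumes "i < N"
  shows "y ^ i = (\<Sum>l<N. newton_coeff x i l * (\<Prod>k<l. y - x k))"
  using assms
proof (induction i)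
  case 0
  have "(\<Sum>l<N. newton_coeff x 0 l * (\<Prod>k<l. y - x k)) =
      (\<Sum>l\<in>{0}. newton_coeff x 0 l * (\<Prod>k<l. y - x k))"
    using 0 by (intro sum.mono_neutral_right) auto
  thus ?case by simp
next
  case (Suc i)
  let ?c = "newton_coeff x i" and ?P = "\<lambda>l. \<Prod>k<l. y - x k"
  obtain N' where N: "N = Suc N'" using Suc by (cases N) auto
  have "y ^ Suc i = (\<Sum>l<N. ?c l * (?P l * y))"
    using Suc by (simp add: sum_distrib_left algebra_simps)
  \<comment> \<open>Writing \<open>y = (y - x l) + x l\<close>, the first part lengthens the product
    by one factor.\<close>
  also have "\<dots> = (\<Sum>l<N. ?c l * ?P (Suc l) + x l * ?c l * ?P l)"
    by (intro sum.cong) (auto simp: algebra_simps)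
  also have "\<dots> = (\<Sum>l<N. ?c l * ?P (Suc l)) + (\<Sum>l<N. x l * ?c l * ?P l)"
    by (rule sum.distrib)
  \<comment> \<open>The last summand drops because \<open>i < N'\<close> makes \<open>?c N'\<close>
    zero.\<close>
  also have "(\<Sum>l<N. ?c l * ?P (Suc l)) = (\<Sum>l<N'. ?c l * ?P (Suc l))"
    using Suc.prems N by (simp add: newton_coeff_eq_0)
  also have "\<dots> = (\<Sum>l<N. (if l = 0 then 0 else ?c (l - 1)) * ?P l)"
    unfolding N by (subst sum.lessThan_Suc_shift) simp
  finally show ?case by (simp add: sum.distrib algebra_simps)
qed

lemma det_vandermonde:
  fixes x :: "nat \<Rightarrow> 'a::comm_ring_1"
  shows "det (mat N N (\<lambda>(i, j). x j ^ i)) = (\<Prod>j<N. \<Prod>k<j. x j - x k)"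
proof -
  let ?L = "mat N N (\<lambda>(i, l). newton_coeff x i l)"
  let ?U = "mat N N (\<lambda>(l, j). \<Prod>k<l. x j - x k)"
  have "mat N N (\<lambda>(i, j). x j ^ i) = ?L * ?U"
    by (rule eq_matI)
       (auto simp: scalar_prod_def power_eq_newton_sum[where x = x and N = N] lessThan_atLeast0)
  hence "det (mat N N (\<lambda>(i, j). x j ^ i)) = det ?L * det ?U"
    by (simp add: det_mult[where n = N])
  also have "det ?L = 1"
    by (subst det_lower_triangular[where n = N])
       (auto simp: newton_coeff_eq_0 newton_coeff_diag prod_list_diag_prod)
  also have "det ?U = (\<Prod>j<N. \<Prod>k<j. x j - x k)"
  proof (subst det_upper_triangular[where n = N])
    show "upper_triangular ?U"
      \<comment> \<open>Below the diagonal \<open>j < l\<close>, so the product has the zero factor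
        \<open>k = j\<close>.\<close>
      by (intro upper_triangularI) (auto intro!: prod_zero)
  qed (auto simp: prod_list_diag_prod lessThan_atLeast0)
  finally show ?thesis by simp
qed

section \<open>Pochhammer symbols and q-binomial coefficients\<close>

lemma q_pochhammer_Suc: "q_pochhammer q q (Suc n) = q_pochhammer q q n * (1 - q ^ Suc n)"
  by (simp add: q_pochhammer_def)

lemma q_pochhammer_nonzero:
  fixes q :: "'a::field"
  assumes "\<And>j. 1 \<le> j \<Longrightarrow> j \<le> n \<Longrightarrow> q ^ j \<noteq> 1"
  shows "q_pochhammer q q n \<noteq> 0"
proof -
  have "1 - q * q ^ k \<noteq> 0" if "k < n" for k
    using assms[of "Suc k"] that by simp
  thus ?thesis by (simp add: q_pochhammer_def)
qed

lemma q_pochhammer_split: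
  "l \<le> N \<Longrightarrow> q_pochhammer q q N = q_pochhammer q q (N - l) * (\<Prod>k<l. 1 - q ^ (N - k))"
proof (induction l)
  case (Suc l)
  hence "N - l = Suc (N - Suc l)" by simp
  thus ?case using Suc by (simp add: q_pochhammer_Suc mult.assoc mult.commute mult.left_commute)
qed simp

lemma prod_power_diff:
  fixes q :: "'a::comm_ring_1"
  assumes "l \<le> N"
  shows "(\<Prod>k<l. q ^ k - q ^ N) = q ^ (l choose 2) * (\<Prod>k<l. 1 - q ^ (N - k))"
  using assms
proof (induction l)
  case (Suc l)
  have "q ^ l - q ^ N = q ^ l * (1 - q ^ (N - l))"
    using Suc.prems by (simp add: right_diff_distrib flip: power_add)
  moreover have "Suc l choose 2 = l + (l choose 2)"
    by (simp add: numeral_2_eq_2)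
  ultimately show ?case using Suc by (simp add: power_add mult_ac)
qed (simp add: numeral_2_eq_2)

lemma q_binomial_eq:
  fixes q :: "'a::field"
  assumes "\<And>j. 1 \<le> j \<Longrightarrow> j \<le> N \<Longrightarrow> q ^ j \<noteq> 1" "l \<le> N"
  shows "q ^ (l choose 2) * q_binomial q N l = (\<Prod>k<l. q ^ k - q ^ N) / q_pochhammer q q l"
proof -
  have "q_pochhammer q q (N - l) \<noteq> 0"
    using assms by (intro q_pochhammer_nonzero) auto
  thus ?thesis
    using assms(2) q_pochhammer_split[OF assms(2), of q]
    by (simp add: q_binomial_def prod_power_diff)
qed

section \<open>Separating row and column indices in the Hankel entries\<close>

definition shifted_factorial_poly :: "'a::comm_ring_1 \<Rightarrow> nat \<Rightarrow> 'a poly" where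
  "shifted_factorial_poly q l = (\<Prod>k<l. [:q ^ k, -1:])"

lemma
  shows poly_shifted_factorial: "poly (shifted_factorial_poly q l) y = (\<Prod>k<l. q ^ k - y)"
    and degree_shifted_factorial: "degree (shifted_factorial_poly q l) \<le> l"
    and coeff_shifted_factorial: "coeff (shifted_factorial_poly q l) l = (-1) ^ l"
  using degree_coeff_prod_of_degree_le[of "{..<l}" "\<lambda>k. [:q ^ k, -1:]" "\<lambda>_. 1"]
  by (simp_all add: shifted_factorial_poly_def poly_prod)

text \<open>The polynomial \<open>E m\<close> of the introduction, with \<open>d\<close> in place of \<open>2 * n\<close>.\<close>
definition hankel_diag :: "'a::field \<Rightarrow> (nat \<Rightarrow> 'a) \<Rightarrow> nat \<Rightarrow> nat \<Rightarrow> 'a poly" where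
  "hankel_diag q \<alpha> d m =
     (\<Sum>l\<le>d. monom (\<alpha> l / q_pochhammer q q l * coeff (shifted_factorial_poly q l) m) (d - l))"

text \<open>Only summands with \<open>l \<ge> m\<close> survive, since
  \<open>shifted_factorial_poly q l\<close> has degree at most \<open>l\<close>.\<close>

lemma degree_hankel_diag: "degree (hankel_diag q \<alpha> d m) \<le> d - m"
  unfolding hankel_diag_def
proof (rule degree_sum_le)
  fix l
  show "degree (monom (\<alpha> l / q_pochhammer q q l * coeff (shifted_factorial_poly q l) m) (d - l)) \<le> d - m"
  proof (cases "l < m")
    case True
    hence "coeff (shifted_factorial_poly q l) m = 0"
      using degree_shifted_factorial[of q l] by (intro coeff_eq_0) simp
    thus ?thesis by simp
  next
    case False
    thus ?thesis by (intro order.trans[OF degree_monom_le]) simp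
  qed
qed simp

lemma coeff_hankel_diag:
  assumes "m \<le> d"
  shows "coeff (hankel_diag q \<alpha> d m) (d - m) = \<alpha> m / q_pochhammer q q m * (-1) ^ m"
proof -
  have "coeff (hankel_diag q \<alpha> d m) (d - m) =
    (\<Sum>l\<le>d. if l = m then \<alpha> l / q_pochhammer q q l * coeff (shifted_factorial_poly q l) m else 0)"
    unfolding hankel_diag_def coeff_sum using assms by (intro sum.cong) auto
  thus ?thesis using assms by (simp add: coeff_shifted_factorial)
qed

lemma monom_mult_alpha_tilde:
  fixes q :: "'a::field"
  assumes q: "\<And>j. 1 \<le> j \<Longrightarrow> j \<le> d \<Longrightarrow> q ^ j \<noteq> 1" and N: "N \<le> d"
  shows "monom 1 d * alpha_tilde q \<alpha> N =
    (\<Sum>m\<le>d. monom ((q ^ N) ^ m) N * hankel_diag q \<alpha> d m)"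
proof -
  let ?a = "\<lambda>l. \<alpha> l / q_pochhammer q q l"
  have "monom 1 d * alpha_tilde q \<alpha> N =
      (\<Sum>l\<le>N. monom (?a l * (\<Prod>k<l. q ^ k - q ^ N)) (d + (N - l)))"
    unfolding alpha_tilde_def sum_distrib_left mult_monom
  proof (intro sum.cong refl)
    fix l assume "l \<in> {..N}"
    hence "q ^ (l choose 2) * q_binomial q N l = (\<Prod>k<l. q ^ k - q ^ N) / q_pochhammer q q l"
      using q N by (intro q_binomial_eq) auto
    thus "monom (1 * (q ^ (l choose 2) * q_binomial q N l * \<alpha> l)) (d + (N - l)) =
        monom (?a l * (\<Prod>k<l. q ^ k - q ^ N)) (d + (N - l))"
      by simp
  qed
  \<comment> \<open>With \<open>l \<le> N \<le> d\<close> both truncated subtractions are exact; the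
    exponent now splits into a part in \<open>N\<close> and a part in \<open>l\<close>.\<close>
  also have "\<dots> = (\<Sum>l\<le>N. monom (?a l * (\<Prod>k<l. q ^ k - q ^ N)) (N + (d - l)))"
    using N by (intro sum.cong) (auto simp: add.commute)
  \<comment> \<open>For \<open>l > N\<close> the product contains the zero factor
    \<open>k = N\<close>, so the range no longer depends on \<open>N\<close>.\<close>
  also have "\<dots> = (\<Sum>l\<le>d. monom (?a l * (\<Prod>k<l. q ^ k - q ^ N)) (N + (d - l)))"
    using N by (intro sum.mono_neutral_left) auto
  also have "\<dots> = (\<Sum>l\<le>d. \<Sum>m\<le>d. monom ((q ^ N) ^ m) N *
      monom (?a l * coeff (shifted_factorial_poly q l) m) (d - l))"
  proof (intro sum.cong refl)
    fix l assume l: "l \<in> {..d}"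
    have "(\<Prod>k<l. q ^ k - q ^ N) = poly (shifted_factorial_poly q l) (q ^ N)"
      by (simp add: poly_shifted_factorial)
    also have "\<dots> = (\<Sum>m\<le>d. coeff (shifted_factorial_poly q l) m * (q ^ N) ^ m)"
      unfolding poly_altdef using l degree_shifted_factorial[of q l]
      by (intro sum.mono_neutral_left) (auto simp: coeff_eq_0)
    finally show "monom (?a l * (\<Prod>k<l. q ^ k - q ^ N)) (N + (d - l)) =
        (\<Sum>m\<le>d. monom ((q ^ N) ^ m) N * monom (?a l * coeff (shifted_factorial_poly q l) m) (d - l))"
      by (simp add: mult_monom sum_distrib_left monom_sum mult_ac)
  qed
  also have "\<dots> = (\<Sum>m\<le>d. monom ((q ^ N) ^ m) N * hankel_diag q \<alpha> d m)"
    unfolding hankel_diag_def sum_distrib_left by (rule sum.swap)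
  finally show ?thesis .
qed

section \<open>Closed form of the leading coefficient\<close>

text \<open>The factor \<open>1 - q ^ j\<close> occurs once for each index from \<open>j\<close> to
  \<open>n\<close>.\<close>

lemma prod_q_pochhammer:
  "(\<Prod>j\<le>n. q_pochhammer q q j) = (\<Prod>j=1..n. (1 - q ^ j) ^ (n + 1 - j))"
proof (induction n)
  case 0
  show ?case by (simp add: q_pochhammer_def)
next
  case (Suc n)
  have "q_pochhammer q q (Suc n) = (\<Prod>j=1..Suc n. 1 - q ^ j)"
    by (induction n) (simp_all add: q_pochhammer_def)
  moreover have "(\<Prod>j=1..Suc n. (1 - q ^ j) ^ (Suc n + 1 - j)) =
      (\<Prod>j=1..Suc n. (1 - q ^ j) ^ (n + 1 - j)) * (\<Prod>j=1..Suc n. 1 - q ^ j)"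
    unfolding prod.distrib[symmetric]
    by (intro prod.cong refl) (auto simp: Suc_diff_le simp flip: power_Suc2)
  ultimately show ?case using Suc by simp
qed

text \<open>For each \<open>j\<close>, the two Vandermonde factors give
  \<open>q ^ (2 * (j choose 2))\<close> and two Pochhammer symbols, one of which cancels the
  denominator; their signs cancel, and only the sign from \<open>\<alpha> j\<close> remains.\<close>

lemma leading_coeff_product:
  fixes q :: "'a::field"
  assumes "\<And>j. 1 \<le> j \<Longrightarrow> j \<le> n \<Longrightarrow> q ^ j \<noteq> 1"
  shows "(\<Prod>m<Suc n. \<alpha> m / q_pochhammer q q m * (-1) ^ m) *
      (\<Prod>j<Suc n. \<Prod>k<j. q ^ j - q ^ k) * (\<Prod>j<Suc n. \<Prod>k<j. q ^ j - q ^ k) =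
    (\<Prod>i\<le>n. \<alpha> i) * (-1) ^ ((n + 1) choose 2) * q ^ (2 * ((n + 1) choose 3))
      * (\<Prod>j=1..n. (1 - q ^ j) ^ (n + 1 - j))"
proof -
  have "\<alpha> j / q_pochhammer q q j * (-1) ^ j * (\<Prod>k<j. q ^ j - q ^ k) * (\<Prod>k<j. q ^ j - q ^ k) =
      \<alpha> j * (-1) ^ j * q ^ (2 * (j choose 2)) * q_pochhammer q q j" if "j \<le> n" for j
  proof -
    have "(\<Prod>k<j. q ^ j - q ^ k) = (\<Prod>k<j. - 1 * (q ^ k - q ^ j))" by simp
    also have "\<dots> = (-1) ^ j * (\<Prod>k<j. q ^ k - q ^ j)"
      unfolding prod.distrib by simp
    also have "(\<Prod>k<j. q ^ k - q ^ j) = q ^ (j choose 2) * q_pochhammer q q j"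
      using prod_power_diff[of j j q] q_pochhammer_split[of j j q] by (simp add: q_pochhammer_def)
    finally have eq: "(\<Prod>k<j. q ^ j - q ^ k) = (-1) ^ j * (q ^ (j choose 2) * q_pochhammer q q j)" .
    have "q_pochhammer q q j \<noteq> 0"
      using that assms by (intro q_pochhammer_nonzero) auto
    thus ?thesis unfolding eq by (simp add: field_simps mult_2 power_add flip: power_mult_distrib)
  qed
  hence "(\<Prod>j\<le>n. \<alpha> j / q_pochhammer q q j * (-1) ^ j * (\<Prod>k<j. q ^ j - q ^ k) * (\<Prod>k<j. q ^ j - q ^ k)) =
      (\<Prod>j\<le>n. \<alpha> j * (-1) ^ j * q ^ (2 * (j choose 2)) * q_pochhammer q q j)"
    by (intro prod.cong) auto
  also have "\<dots> = (\<Prod>i\<le>n. \<alpha> i) * (-1) ^ (\<Sum>j\<le>n. j) * q ^ (2 * (\<Sum>j\<le>n. j choose 2))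
      * (\<Prod>j\<le>n. q_pochhammer q q j)"
    by (simp add: prod.distrib power_sum sum_distrib_left)
  \<comment> \<open>Both exponent sums are instances of the hockey-stick identity.\<close>
  also have "(\<Sum>j\<le>n. j) = (n + 1) choose 2"
    using sum_choose_upper[of 1 n] by (simp add: numeral_2_eq_2)
  also have "(\<Sum>j\<le>n. j choose 2) = (n + 1) choose 3"
    using sum_choose_upper[of 2 n] by (simp add: eval_nat_numeral)
  finally show ?thesis
    unfolding prod.distrib lessThan_Suc_atMost prod_q_pochhammer .
qed

section \<open>Degree and top coefficient of a single term\<close>

text \<open>The row factors have total degree at most \<open>S + d * N - sum f {..<N}\<close> and
  the determinant adds at most \<open>S\<close>. The top degree thus requires
  \<open>sum f {..<N} \<le> S\<close>, which for injective \<open>f\<close> forces a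
  permutation.\<close>

lemma hankel_det_term:
  fixes q :: "'a::field" and \<alpha> :: "nat \<Rightarrow> 'a"
  assumes f: "\<forall>i\<in>{0..<N}. f i \<le> d" "\<forall>i. i \<notin> {0..<N} \<longrightarrow> f i = i" and d: "N \<le> Suc d"
  defines "S \<equiv> \<Sum>i<N. i"
  defines "T \<equiv> (\<Prod>i<N. monom (q ^ (i * f i)) i * hankel_diag q \<alpha> d (f i)) *
    det (mat N N (\<lambda>(i, j). monom (q ^ (j * f i)) j))"
  shows "degree T \<le> S + d * N \<and> coeff T (S + d * N) =
    (if f permutes {0..<N} then signof f * (\<Prod>i = 0..<N. q ^ (i * f i)) *
       (\<Prod>m<N. \<alpha> m / q_pochhammer q q m * (-1) ^ m) * (\<Prod>j<N. \<Prod>k<j. q ^ j - q ^ k) else 0)"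
proof (cases "inj_on f {..<N}")
  case False
  then obtain i j where ij: "i < N" "j < N" "i \<noteq> j" "f i = f j"
    unfolding inj_on_def by auto
  have "det (mat N N (\<lambda>(i, j). monom (q ^ (j * f i)) j)) = 0"
    by (rule det_identical_rows[where n = N and i = i and j = j]) (use ij in auto)
  moreover have "\<not> f permutes {0..<N}"
    using False permutes_inj_on by blast
  ultimately show ?thesis by (simp add: T_def)
next
  case inj: True
  let ?p = "\<lambda>i. monom (q ^ (i * f i)) i * hankel_diag q \<alpha> d (f i)"
  define D where "D = det (mat N N (\<lambda>(i, j). q ^ (j * f i)))"
  define K where "K = (\<Sum>i<N. i + (d - f i))"
  have T: "T = (\<Prod>i<N. ?p i) * monom D S"
    by (simp add: T_def D_def S_def det_mat_monom_cols)
  have degp: "degree (?p i) \<le> i + (d - f i)" for i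
    using degree_mult_le[of "monom (q ^ (i * f i)) i" "hankel_diag q \<alpha> d (f i)"]
      degree_hankel_diag[of q \<alpha> d "f i"] degree_monom_le[of "q ^ (i * f i)" i] by linarith
  have prod: "degree (\<Prod>i<N. ?p i) \<le> K" "coeff (\<Prod>i<N. ?p i) K = (\<Prod>i<N. coeff (?p i) (i + (d - f i)))"
    using degree_coeff_prod_of_degree_le[of "{..<N}" ?p "\<lambda>i. i + (d - f i)"] degp
    by (simp_all add: K_def)
  have "(\<Sum>i<N. (d - f i) + f i) = d * N" using f by simp
  hence K: "K + sum f {..<N} = S + d * N"
    by (simp add: K_def S_def sum.distrib)
  have sum_image: "sum f {..<N} = \<Sum>(f ` {..<N})"
    using inj by (simp add: sum.reindex)
  have "card (f ` {..<N}) = N" using inj by (simp add: card_image)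
  hence ge: "S \<le> sum f {..<N}" and eqD: "S = sum f {..<N} \<longrightarrow> f ` {..<N} = {..<N}"
    using sum_lessThan_card_le[of "f ` {..<N}" N] unfolding sum_image S_def by auto
  have degT: "degree T \<le> K + S"
    unfolding T using degree_mult_le[of "\<Prod>i<N. ?p i" "monom D S"] prod(1) degree_monom_le[of D S] by linarith
  show ?thesis
  proof (cases "f permutes {0..<N}")
    case False
    have "f ` {..<N} \<noteq> {..<N}"
    proof
      assume "f ` {..<N} = {..<N}"
      hence "f permutes {0..<N}"
        using inj f by (intro bij_imp_permutes) (auto simp: bij_betw_def lessThan_atLeast0)
      with False show False by contradiction
    qed
    hence "S < sum f {..<N}" using ge eqD by (simp add: order.strict_iff_order)
    hence "degree T < S + d * N" using degT K by linarith
    thus ?thesis using False by (simp add: coeff_eq_0)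
  next
    case perm: True
    have "sum f {..<N} = S"
      using sum.permute[OF perm, of id] by (simp add: S_def lessThan_atLeast0 comp_def)
    hence KS: "K + S = S + d * N" using K by simp
    have "coeff T (K + S) = (\<Prod>i<N. coeff (?p i) (i + (d - f i))) * D"
      unfolding T using prod by (subst coeff_mult_of_degree_le) (auto simp: degree_monom_le)
    also have "(\<Prod>i<N. coeff (?p i) (i + (d - f i))) =
        (\<Prod>i<N. q ^ (i * f i) * (\<alpha> (f i) / q_pochhammer q q (f i) * (-1) ^ f i))"
      using f(1) by (intro prod.cong refl)
        (simp only: coeff_mult_of_degree_le[OF degree_monom_le degree_hankel_diag], simp add: coeff_hankel_diag)
    also have "\<dots> = (\<Prod>i = 0..<N. q ^ (i * f i)) * (\<Prod>m<N. \<alpha> m / q_pochhammer q q m * (-1) ^ m)"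
      using prod.permute[OF perm, of "\<lambda>m. \<alpha> m / q_pochhammer q q m * (-1) ^ m"]
      unfolding prod.distrib[of "\<lambda>i. q ^ (i * f i)"] by (simp add: lessThan_atLeast0 comp_def)
    also have "D = signof f * (\<Prod>j<N. \<Prod>k<j. q ^ j - q ^ k)"
    proof -
      \<comment> \<open>The determinant \<open>D\<close> is that of a Vandermonde matrix with rows
        permuted by \<open>f\<close>; this yields the sign and the first Vandermonde factor.\<close>
      let ?V = "mat N N (\<lambda>(i, j). (q ^ j) ^ i)"
      have "mat N N (\<lambda>(i, j). q ^ (j * f i)) = mat N N (\<lambda>(i, j). ?V $$ (f i, j))"
        using perm by (intro eq_matI) (auto simp: power_mult permutes_in_image)
      hence "D = signof f * det ?V"
        unfolding D_def by (simp only: det_permute_rows[OF mat_carrier perm])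
      thus ?thesis by (simp only: det_vandermonde)
    qed
    finally have "coeff T (K + S) = signof f * (\<Prod>i = 0..<N. q ^ (i * f i)) *
       (\<Prod>m<N. \<alpha> m / q_pochhammer q q m * (-1) ^ m) * (\<Prod>j<N. \<Prod>k<j. q ^ j - q ^ k)"
      by (simp only: mult_ac)
    thus ?thesis using perm degT by (simp only: KS if_True simp_thms)
  qed
qed

text \<open>Scaling the whole matrix by the power \<open>2 * n\<close> of the variable multiplies
  the determinant by its \<open>Suc n\<close>-th power.\<close>

lemma monom_mult_hankel_det:
  fixes q :: "'a::field"
  assumes "\<And>j. 1 \<le> j \<Longrightarrow> j \<le> 2 * n \<Longrightarrow> q ^ j \<noteq> 1"
  shows "monom 1 (2 * n * Suc n) * hankel_det (alpha_tilde q \<alpha>) n =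
    (\<Sum>f | (\<forall>i\<in>{0..<Suc n}. f i \<in> {..2 * n}) \<and> (\<forall>i. i \<notin> {0..<Suc n} \<longrightarrow> f i = i).
       (\<Prod>i<Suc n. monom (q ^ (i * f i)) i * hankel_diag q \<alpha> (2 * n) (f i)) *
       det (mat (Suc n) (Suc n) (\<lambda>(i, j). monom (q ^ (j * f i)) j)))"
proof -
  let ?A = "mat (Suc n) (Suc n) (\<lambda>(i, j). alpha_tilde q \<alpha> (i + j))"
  have "monom 1 (2 * n) \<cdot>\<^sub>m ?A = mat (Suc n) (Suc n) (\<lambda>(i, j). \<Sum>m\<le>2 * n.
      (monom (q ^ (i * m)) i * hankel_diag q \<alpha> (2 * n) m) * monom (q ^ (j * m)) j)" (is "_ = ?B")
  proof (rule eq_matI)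
    fix i j assume "i < dim_row ?B" "j < dim_col ?B"
    hence ij: "i \<le> n" "j \<le> n" by auto
    hence "monom 1 (2 * n) * alpha_tilde q \<alpha> (i + j) =
        (\<Sum>m\<le>2 * n. monom ((q ^ (i + j)) ^ m) (i + j) * hankel_diag q \<alpha> (2 * n) m)"
      using assms by (intro monom_mult_alpha_tilde) auto
    also have "\<dots> = (\<Sum>m\<le>2 * n. (monom (q ^ (i * m)) i * hankel_diag q \<alpha> (2 * n) m) * monom (q ^ (j * m)) j)"
    proof (intro sum.cong refl)
      fix m
      have "monom ((q ^ (i + j)) ^ m) (i + j) = monom (q ^ (i * m)) i * monom (q ^ (j * m)) j"
        by (simp add: mult_monom power_add power_mult power_mult_distrib)
      thus "monom ((q ^ (i + j)) ^ m) (i + j) * hankel_diag q \<alpha> (2 * n) m =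
          (monom (q ^ (i * m)) i * hankel_diag q \<alpha> (2 * n) m) * monom (q ^ (j * m)) j"
        by (simp only: mult_ac)
    qed
    finally show "(monom 1 (2 * n) \<cdot>\<^sub>m ?A) $$ (i, j) = ?B $$ (i, j)"
      using ij by simp
  qed auto
  hence "det (monom 1 (2 * n) \<cdot>\<^sub>m ?A) = det ?B" by (simp only:)
  also have "det (monom 1 (2 * n) \<cdot>\<^sub>m ?A) = monom 1 (2 * n * Suc n) * hankel_det (alpha_tilde q \<alpha>) n"
    unfolding det_smult monom_power by (simp only: hankel_det_def dim_col_mat power_one Suc_eq_plus1)
  finally show ?thesis by (simp only: det_mat_row_sums[OF finite_atMost])
qed

text \<open>The bound \<open>2 * n\<close> on \<open>j\<close> comes from the largest index of
  \<open>alpha_tilde\<close> in the matrix. Exact degree is claimed only for nonzero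
  \<open>q\<close> and \<open>\<alpha> i\<close>: the coefficient vanishes if some
  \<open>\<alpha> i\<close> with \<open>i \<le> n\<close> is 0, or if \<open>q = 0\<close> and
  \<open>n \<ge> 2\<close>.\<close>

theorem theorem1p5:
  fixes q :: "'a::field" and \<alpha> :: "nat \<Rightarrow> 'a" and n :: nat
  assumes "\<And>j. 1 \<le> j \<Longrightarrow> j \<le> 2 * n \<Longrightarrow> q ^ j \<noteq> 1"
  shows "degree (hankel_det (alpha_tilde q \<alpha>) n) \<le> n * (n + 1) div 2
    \<and> coeff (hankel_det (alpha_tilde q \<alpha>) n) (n * (n + 1) div 2)
        = (\<Prod>i\<le>n. \<alpha> i) * (-1) ^ ((n + 1) choose 2) * q ^ (2 * ((n + 1) choose 3))
          * (\<Prod>j=1..n. (1 - q ^ j) ^ (n + 1 - j))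
    \<and> (q \<noteq> 0 \<and> (\<forall>i\<le>n. \<alpha> i \<noteq> 0) \<longrightarrow>
        degree (hankel_det (alpha_tilde q \<alpha>) n) = n * (n + 1) div 2)"
proof -
  let ?P = "hankel_det (alpha_tilde q \<alpha>) n" and ?N = "Suc n" and ?s = "n * (n + 1) div 2"
  let ?C = "(\<Prod>i\<le>n. \<alpha> i) * (-1) ^ ((n + 1) choose 2) * q ^ (2 * ((n + 1) choose 3))
          * (\<Prod>j=1..n. (1 - q ^ j) ^ (n + 1 - j))"
  define F where "F = {f. (\<forall>i\<in>{0..<?N}. f i \<in> {..2 * n}) \<and> (\<forall>i. i \<notin> {0..<?N} \<longrightarrow> f i = i)}"
  define T where "T f = (\<Prod>i<?N. monom (q ^ (i * f i)) i * hankel_diag q \<alpha> (2 * n) (f i)) *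
       det (mat ?N ?N (\<lambda>(i, j). monom (q ^ (j * f i)) j))" for f
  define A where "A = (\<Prod>m<?N. \<alpha> m / q_pochhammer q q m * (-1) ^ m)"
  define V where "V = (\<Prod>j<?N. \<Prod>k<j. q ^ j - q ^ k)"
  have s: "(\<Sum>i<?N. i) = ?s"
    using gauss_sum_nat[of n] by (simp add: lessThan_Suc_atMost atLeast0AtMost)
  have P: "monom 1 (2 * n * ?N) * ?P = sum T F"
    unfolding F_def T_def using assms by (rule monom_mult_hankel_det)
  have T: "degree (T f) \<le> ?s + 2 * n * ?N" "coeff (T f) (?s + 2 * n * ?N) =
      (if f permutes {0..<?N} then signof f * (\<Prod>i = 0..<?N. q ^ (i * f i)) * A * V else 0)"
    if "f \<in> F" for f
    using hankel_det_term[of ?N f "2 * n" q \<alpha>] that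
    unfolding s T_def A_def V_def F_def by auto
  have fin: "finite F"
    unfolding F_def by (rule finite_bounded_functions) auto
  \<comment> \<open>Multiplication by the monomial only shifts coefficients, so those of
    \<open>?P\<close> can be read off from the expansion.\<close>
  have coeff_P: "coeff ?P k = coeff (sum T F) (k + 2 * n * ?N)" for k
    unfolding P[symmetric] coeff_monom_mult by simp
  have deg: "degree ?P \<le> ?s"
  proof (rule degree_le, intro allI impI)
    fix k assume "?s < k"
    moreover have "degree (sum T F) \<le> ?s + 2 * n * ?N"
      using fin T(1) by (rule degree_sum_le)
    ultimately show "coeff ?P k = 0"
      unfolding coeff_P by (intro coeff_eq_0) linarith
  qed
  have "coeff ?P ?s = (\<Sum>f\<in>F. if f permutes {0..<?N} then signof f * (\<Prod>i = 0..<?N. q ^ (i * f i)) * A * V else 0)"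
    unfolding coeff_P coeff_sum using T(2) by (intro sum.cong) auto
  also have "\<dots> = (\<Sum>f | f permutes {0..<?N}. signof f * (\<Prod>i = 0..<?N. q ^ (i * f i)) * A * V)"
  proof (intro sum.mono_neutral_cong_right fin ballI)
    show "{f. f permutes {0..<?N}} \<subseteq> F"
    proof
      fix f assume "f \<in> {f. f permutes {0..<?N}}"
      hence f: "f permutes {0..<?N}" by simp
      have "f i \<le> 2 * n" if "i < ?N" for i
        using permutes_in_image[OF f, of i] that by auto
      thus "f \<in> F" using f by (auto simp: F_def permutes_def)
    qed
  qed auto
  \<comment> \<open>Regrouping the powers of \<open>q\<close> turns the sum over \<open>f\<close>
    into the Leibniz formula of a Vandermonde determinant, which is the second factor
    \<open>V\<close>.\<close>
  also have "\<dots> = (\<Sum>f | f permutes {0..<?N}. signof f * (\<Prod>i = 0..<?N. (q ^ f i) ^ i)) * A * V"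
    by (simp add: sum_distrib_right power_mult[symmetric] mult.commute[of _ "_::nat"])
  also have "(\<Sum>f | f permutes {0..<?N}. signof f * (\<Prod>i = 0..<?N. (q ^ f i) ^ i)) =
      det (mat ?N ?N (\<lambda>(i, j). (q ^ j) ^ i))"
    by (subst det_def'[where n = ?N]) (auto intro!: sum.cong prod.cong)
  also have "\<dots> = V"
    unfolding det_vandermonde V_def ..
  also have "V * A * V = ?C"
  proof -
    have "A * V * V = ?C"
      unfolding A_def V_def using assms by (intro leading_coeff_product) auto
    thus ?thesis by (simp only: mult_ac)
  qed
  finally have lead: "coeff ?P ?s = ?C" .
  have "degree ?P = ?s" if "q \<noteq> 0" "\<forall>i\<le>n. \<alpha> i \<noteq> 0"
  proof (rule antisym[OF deg le_degree])
    have "1 - q ^ j \<noteq> 0" if "j \<in> {1..n}" for j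
      using assms[of j] that by auto
    thus "coeff ?P ?s \<noteq> 0"
      unfolding lead using that by simp
  qed
  with deg lead show ?thesis by blast
qed

end
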